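(* Let $\mathcal{B}\subset\mathbb{R}$ be the Brjuno set. For every $\sigma>2$, the complement $\mathbb{R}\setminus\mathcal{B}$ has zero $C^1_\sigma$-capacity, i.e. $C^1_\sigma(\mathbb{R}\setminus\mathcal{B})=0$, where $C^1_\sigma$ is the capacity associated with the kernel $$k^1_\sigma(z,\xi)=\ln^2|z-\xi|\,\left|\ln\ln\left(e+\frac{1}{|z-\xi|}\right)\right|^\sigma .$$ In particular, for every $\sigma>2$, $\mathbb{R}\setminus\mathcal{B}$ has zero Hausdorff $H^{h^1_\sigma}$-measure with respect to the gauge function $$h^1_\sigma(t)=\ln^{-2}\frac1t\cdot\ln^{-\sigma}\ln\frac1t,\qquad 0\le t\le e^{-2}$$ (with $h^1_\sigma(0)=0$).
   Context: **Continued fractions.** For irrational $\alpha\in\mathbb{R}$ put $a_0=[\alpha]$ (integer part), $\alpha_0=\alpha-[\alpha]$, and inductively $a_{n+1}=[1/\alpha_n]$, $\alpha_{n+1}=1/\alpha_n-[1/\alpha_n]$. Then $\alpha=[a_0,a_1,a_2,\dots]=a_0+\cfrac{1}{a_1+\cfrac{1}{a_2+\cdots}}$ with $a_j\ge 1$ integers for $j\ge1$. The $n$-th convergent is $P_n/Q_n=[a_0,a_1,\dots,a_n]$, in lowest terms with $Q_n\ge1$. **Brjuno set.** An irrational $\alpha\in\mathbb{R}$ is a Brjuno number if $\sum_{n=1}^\infty \frac{\ln Q_{n+1}}{Q_n}<+\infty$. $\mathcal{B}$ is the set of all Brjuno numbers (so $\mathbb{R}\setminus\mathcal{B}$ contains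 all rationals). **Notation.** $\ln^a x$ means $(\ln x)^a$, $\ln^a\ln x$ means $(\ln\ln x)^a$. **Capacity.** The kernel $k=k^1_\sigma$ on $\mathbb{C}\times\mathbb{C}$ takes the value $+\infty$ on the diagonal $z=\xi$. For a compact set $K\subset\mathbb{C}$ let $W(K)=\inf_\mu \iint_{K\times K}k(z,\xi)\,d\mu(z)\,d\mu(\xi)$, the infimum being over Borel probability measures $\mu$ supported on $K$, and $C(K)=W(K)^{-1}$ (with $1/(+\infty)=0$, and $C(\emptyset)=0$). For a Borel set $E\subset\mathbb{C}$ the inner capacity is $\underline{C}(E)=\sup\{C(K):K\subset E,\ K\text{ compact}\}$ and the outer capacity is $\overline{C}(E)=\inf\{C(U):U\supset E,\ U\text{ open}\}$, where for open $U$ one sets $C(U)=\underline C(U)$. For Borel sets the two coincide, and the common value is denoted $C(E)$; for this kernel it is written $C^1_\sigma(E)$. Here $\mathbb{R}\subset\mathbb{C}$. **Hausdorff $H^h$-measure.** Let $h:[0,r_0]\to[0,+\infty)$ be continuous and strictly increasing with $h(0)=0$. For $E\subset\mathbb{R}^n$ (here $n=1$) and $0<\varepsilon\le r_0$ let $H^h(E,\varepsilon)=\inf\sum_j h(r_j)$, the infimum being over all countable coverings of $E$ by open balls $B_j$ of radii $r_j<\varepsilon$, and $H^h(E)=\lim_{\varepsilon\to0+}H^h(E,\varepsilon)$. *)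

theory Defs
  imports "HOL-Probability.Probability"
begin

subsection \<open>Continued fractions and the Brjuno set\<close>

primrec cf_rem :: "real \<Rightarrow> nat \<Rightarrow> real" where
  "cf_rem \<alpha> 0 = \<alpha> - of_int \<lfloor>\<alpha>\<rfloor>"
| "cf_rem \<alpha> (Suc n) = 1 / cf_rem \<alpha> n - of_int \<lfloor>1 / cf_rem \<alpha> n\<rfloor>"

fun cf_coeff :: "real \<Rightarrow> nat \<Rightarrow> int" where
  "cf_coeff \<alpha> 0 = \<lfloor>\<alpha>\<rfloor>"
| "cf_coeff \<alpha> (Suc n) = \<lfloor>1 / cf_rem \<alpha> n\<rfloor>"

fun cf_value :: "int list \<Rightarrow> rat" where
  "cf_value [] = 0"
| "cf_value [a] = of_int a"
| "cf_value (a # b # as) = of_int a + 1 / cf_value (b # as)"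

definition cf_convergent :: "real \<Rightarrow> nat \<Rightarrow> rat" where
  "cf_convergent \<alpha> n = cf_value (map (cf_coeff \<alpha>) [0..<Suc n])"

text \<open>\<^const>\<open>quotient_of\<close> yields the representation in lowest terms with positive denominator.\<close>

definition cf_denom :: "real \<Rightarrow> nat \<Rightarrow> int" where
  "cf_denom \<alpha> n = snd (quotient_of (cf_convergent \<alpha> n))"

text \<open>The series \<open>\<Sum>n\<ge>1. ln Q\<^sub>n\<^sub>+\<^sub>1 / Q\<^sub>n\<close> is reindexed to start at 0. Its terms are
  nonnegative, so summability is the same as finiteness of the sum.\<close>

definition brjuno_set :: "real set" where
  "brjuno_set = {\<alpha>. \<alpha> \<notin> \<rat> \<and>
     summable (\<lambda>n. ln (real_of_int (cf_denom \<alpha> (n + 2))) / real_of_int (cf_denom \<alpha> (n + 1)))}"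


subsection \<open>Capacity with respect to a nonnegative kernel\<close>

definition prob_measures_on :: "complex set \<Rightarrow> complex measure set" where
  "prob_measures_on K = {\<mu>. prob_space \<mu> \<and> sets \<mu> = sets borel \<and> emeasure \<mu> (- K) = 0}"

definition min_energy :: "(complex \<Rightarrow> complex \<Rightarrow> ennreal) \<Rightarrow> complex set \<Rightarrow> ennreal" where
  "min_energy k K =
     (INF \<mu>\<in>prob_measures_on K. \<integral>\<^sup>+z\<in>K. (\<integral>\<^sup>+\<xi>\<in>K. k z \<xi> \<partial>\<mu>) \<partial>\<mu>)"

text \<open>In \<^typ>\<open>ennreal\<close> the inverse of \<open>\<infinity>\<close> is 0, and the infimum over the empty family is \<open>\<infinity>\<close>, so
  that the empty set has capacity 0.\<close>

definition compact_capacity :: "(complex \<Rightarrow> complex \<Rightarrow> ennreal) \<Rightarrow> complex set \<Rightarrow> ennreal" where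
  "compact_capacity k K = inverse (min_energy k K)"

definition inner_capacity :: "(complex \<Rightarrow> complex \<Rightarrow> ennreal) \<Rightarrow> complex set \<Rightarrow> ennreal" where
  "inner_capacity k E = (SUP K\<in>{K. compact K \<and> K \<subseteq> E}. compact_capacity k K)"

definition outer_capacity :: "(complex \<Rightarrow> complex \<Rightarrow> ennreal) \<Rightarrow> complex set \<Rightarrow> ennreal" where
  "outer_capacity k E = (INF U\<in>{U. open U \<and> E \<subseteq> U}. inner_capacity k U)"

text \<open>The capacity of a Borel set is the common value of its inner and outer capacities.\<close>

definition has_capacity ::
    "(complex \<Rightarrow> complex \<Rightarrow> ennreal) \<Rightarrow> complex set \<Rightarrow> ennreal \<Rightarrow> bool" where
  "has_capacity k E c \<longleftrightarrow> E \<in> sets borel \<and> inner_capacity k E = c \<and> outer_capacity k E = c"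

definition brjuno_kernel :: "real \<Rightarrow> complex \<Rightarrow> complex \<Rightarrow> ennreal" where
  "brjuno_kernel \<sigma> z \<xi> =
     (if z = \<xi> then \<infinity>
      else ennreal ((ln (cmod (z - \<xi>)))\<^sup>2 *
                    \<bar>ln (ln (exp 1 + 1 / cmod (z - \<xi>)))\<bar> powr \<sigma>))"


subsection \<open>Hausdorff measure with respect to a gauge function\<close>

text \<open>The index set \<open>I\<close> ranges over arbitrary sets of natural numbers, so finite coverings are
  included. The gauge is only evaluated at radii below \<open>\<epsilon>\<close>; as only the limit \<open>\<epsilon> \<rightarrow> 0+\<close> matters,
  its values outside a right neighbourhood of 0 are irrelevant.\<close>

definition hausdorff_pre :: "(real \<Rightarrow> real) \<Rightarrow> real \<Rightarrow> 'a::metric_space set \<Rightarrow> ennreal" where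
  "hausdorff_pre h \<epsilon> E =
     Inf {(\<Sum>\<^sub>\<infinity>j\<in>I. ennreal (h (r j))) |(I :: nat set) (c :: nat \<Rightarrow> 'a) r.
            (\<forall>j\<in>I. 0 < r j \<and> r j < \<epsilon>) \<and> E \<subseteq> (\<Union>j\<in>I. ball (c j) (r j))}"

definition hausdorff_measure :: "(real \<Rightarrow> real) \<Rightarrow> 'a::metric_space set \<Rightarrow> ennreal" where
  "hausdorff_measure h E = Lim (at_right 0) (\<lambda>\<epsilon>. hausdorff_pre h \<epsilon> E)"

text \<open>Meaningful for \<open>0 \<le> t \<le> exp (-2)\<close>, where \<open>ln (1/t) \<ge> 2\<close> and \<open>ln (ln (1/t)) > 0\<close>.\<close>

definition brjuno_gauge :: "real \<Rightarrow> real \<Rightarrow> real" where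
  "brjuno_gauge \<sigma> t =
     (if t = 0 then 0 else ln (1 / t) powr (-2) * ln (ln (1 / t)) powr (-\<sigma>))"

end

theory Submission
  imports Defs "HOL-Real_Asymp.Real_Asymp"
begin

text \<open>If \<open>ln Q\<^sub>n\<^sub>+\<^sub>1 < Q\<^sub>n / sqrt (ln Q\<^sub>n)\<close> for all large \<open>n\<close>, then the Brjuno series converges: the
  terms with \<open>ln Q\<^sub>n\<^sub>+\<^sub>1 \<le> sqrt Q\<^sub>n\<close> are dominated by a geometric series, and the others by the
  telescoping differences of \<open>2 / sqrt (ln Q\<^sub>n)\<close>. Hence a non-Brjuno number \<open>\<alpha>\<close> satisfies
  \<open>\<bar>\<alpha> - p/q\<bar> < \<rho>\<^sub>q / 2\<close> with \<open>\<rho>\<^sub>q = exp (- q / sqrt (ln q))\<close> for infinitely many \<open>q\<close>; a rational number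
  does so trivially, through its non-reduced representations. The gauge of \<open>\<rho>\<^sub>q\<close> is of order
  \<open>q\<^sup>-\<^sup>2 (ln q)\<^sup>1\<^sup>-\<^sup>\<sigma>\<close>, so there is room to use \<open>2 q (ln q)\<^sup>\<tau> + 1\<close> numerators \<open>p\<close> for each \<open>q\<close>, where
  \<open>\<tau> = (\<sigma> - 2) / 2\<close>: the resulting series \<open>\<Sum>\<^sub>q 1 / (q (ln q)\<^sup>1\<^sup>+\<^sup>\<tau>)\<close> converges. As \<open>(ln q)\<^sup>\<tau>\<close> is unbounded,
  the tails of this one family of balls cover the whole (unbounded) complement of the Brjuno set.
  For the capacity, the Cauchy--Schwarz inequality shows that the capacity of a union of balls of
  diameters \<open>t\<^sub>j\<close> is at most the sum of the gauges of the \<open>t\<^sub>j\<close>.\<close>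

subsection \<open>Denominators of the convergents\<close>

text \<open>Classical recurrences for the numerators and denominators of
  \<open>[a 0, ..., a n]\<close>. Two base cases replace the usual convention at index -1.\<close>

fun cont_num :: "(nat \<Rightarrow> int) \<Rightarrow> nat \<Rightarrow> int" where
  "cont_num a 0 = a 0"
| "cont_num a (Suc 0) = a 1 * a 0 + 1"
| "cont_num a (Suc (Suc n)) = a (Suc (Suc n)) * cont_num a (Suc n) + cont_num a n"

fun cont_den :: "(nat \<Rightarrow> int) \<Rightarrow> nat \<Rightarrow> int" where
  "cont_den a 0 = 1"
| "cont_den a (Suc 0) = a 1"
| "cont_den a (Suc (Suc n)) = a (Suc (Suc n)) * cont_den a (Suc n) + cont_den a n"

text \<open>The recurrences split off the last coefficient, \<open>cf_value\<close> the first one.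
  This identity and the next translate between the two.\<close>

lemma cont_num_shift:
  "cont_num a (Suc n) = a 0 * cont_num (a \<circ> Suc) n + cont_den (a \<circ> Suc) n"
  by (induction a n rule: cont_num.induct) (auto simp: algebra_simps)

lemma cont_den_shift: "cont_den a (Suc n) = cont_num (a \<circ> Suc) n"
  by (induction a n rule: cont_den.induct) (auto simp: algebra_simps)

lemma cont_den_pos:
  assumes "\<And>i. i > 0 \<Longrightarrow> a i > 0"
  shows "cont_den a n > 0"
  using assms by (induction a n rule: cont_den.induct) (auto simp: add_pos_pos)

lemma cf_value_eq_cont:
  assumes "\<And>i. i > 0 \<Longrightarrow> a i > 0"
  shows "cf_value (map a [0..<Suc n]) = of_int (cont_num a n) / of_int (cont_den a n)"
  using assms
proof (induction n arbitrary: a)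
  case (Suc n)
  have *: "map a [0..<Suc (Suc n)] = a 0 # map (a \<circ> Suc) [0..<Suc n]"
    by (simp add: map_upt_Suc del: upt_Suc)
  have "map (a \<circ> Suc) [0..<Suc n] \<noteq> []" by simp
  then have **: "cf_value (a 0 # map (a \<circ> Suc) [0..<Suc n])
      = of_int (a 0) + 1 / cf_value (map (a \<circ> Suc) [0..<Suc n])"
    by (metis cf_value.simps(3) list.exhaust)
  have IH: "cf_value (map (a \<circ> Suc) [0..<Suc n])
      = of_int (cont_num (a \<circ> Suc) n) / of_int (cont_den (a \<circ> Suc) n)"
    by (rule Suc.IH) (use Suc.prems in auto)
  \<comment> \<open>This is the numerator of the tail, so the reciprocal of the tail is a genuine
    one.\<close>
  have "cont_den a (Suc n) > 0" by (rule cont_den_pos) (use Suc.prems in auto)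
  then have "cont_num (a \<circ> Suc) n > 0" by (simp add: cont_den_shift)
  then show ?case
    unfolding * ** IH cont_num_shift[of a n] cont_den_shift[of a n] by (simp add: field_simps)
qed auto

text \<open>The terms containing the new coefficient cancel, leaving the previous determinant with
  its sign reversed.\<close>

lemma cont_det:
  "cont_num a (Suc n) * cont_den a n - cont_num a n * cont_den a (Suc n) = (-1) ^ n"
  by (induction n) (auto simp: algebra_simps)

lemma coprime_cont: "coprime (cont_num a n) (cont_den a n)"
proof (rule coprimeI)
  fix c assume "c dvd cont_num a n" "c dvd cont_den a n"
  then have "c dvd cont_num a (Suc n) * cont_den a n - cont_num a n * cont_den a (Suc n)"
    by auto
  then have "c dvd (-1) ^ n" by (simp only: cont_det)
  then show "is_unit c" by (cases "even n") (auto simp: is_unit_power_iff)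
qed

section \<open>Convergents of a fixed irrational number\<close>

context
  fixes \<alpha> :: real
  assumes irr: "\<alpha> \<notin> \<rat>"
begin

lemma cf_rem_irrational: "cf_rem \<alpha> n \<notin> \<rat>"
proof (induction n)
  case 0
  show ?case
  proof
    assume "cf_rem \<alpha> 0 \<in> \<rat>"
    then have "cf_rem \<alpha> 0 + of_int \<lfloor>\<alpha>\<rfloor> \<in> \<rat>" by (intro Rats_add Rats_of_int)
    with irr show False by simp
  qed
next
  case (Suc n)
  show ?case
  proof
    assume "cf_rem \<alpha> (Suc n) \<in> \<rat>"
    then have "cf_rem \<alpha> (Suc n) + of_int \<lfloor>1 / cf_rem \<alpha> n\<rfloor> \<in> \<rat>"
      by (intro Rats_add Rats_of_int)
    then have "1 / cf_rem \<alpha> n \<in> \<rat>" by simp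
    then have "inverse (1 / cf_rem \<alpha> n) \<in> \<rat>" by (rule Rats_inverse)
    with Suc show False by simp
  qed
qed

lemma cf_rem_bounds: "0 < cf_rem \<alpha> n" "cf_rem \<alpha> n < 1"
proof -
  have "cf_rem \<alpha> n \<noteq> 0" using cf_rem_irrational[of n] by auto
  moreover have "0 \<le> cf_rem \<alpha> n \<and> cf_rem \<alpha> n < 1" by (cases n) (simp; linarith)+
  ultimately show "0 < cf_rem \<alpha> n" "cf_rem \<alpha> n < 1" by auto
qed

lemma cf_coeff_pos: "i > 0 \<Longrightarrow> cf_coeff \<alpha> i > 0"
  using cf_rem_bounds by (cases i) (auto simp: less_eq_real_def field_simps)

lemma cont_den_cf_coeff_pos: "cont_den (cf_coeff \<alpha>) n > 0"
  by (rule cont_den_pos) (rule cf_coeff_pos)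

text \<open>The continuants are coprime and the lower one is positive, so reduction to lowest terms
  changes nothing.\<close>

lemma cf_denom_eq_cont: "cf_denom \<alpha> n = cont_den (cf_coeff \<alpha>) n"
proof -
  let ?p = "cont_num (cf_coeff \<alpha>) n" and ?q = "cont_den (cf_coeff \<alpha>) n"
  have q: "?q > 0" by (rule cont_den_cf_coeff_pos)
  have "cf_convergent \<alpha> n = of_int ?p / of_int ?q"
    unfolding cf_convergent_def by (rule cf_value_eq_cont) (rule cf_coeff_pos)
  then have "cf_convergent \<alpha> n = Fract ?p ?q" by (simp add: Fract_of_int_quotient)
  then show ?thesis
    using q coprime_cont[of "cf_coeff \<alpha>" n]
    by (simp add: cf_denom_def quotient_of_Fract Rat.normalize_def coprime_iff_gcd_eq_1)
qed

text \<open>This is \<open>\<alpha> = [a 0, ..., a (n+1), 1/t]\<close> with \<open>t\<close> the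
  remainder of index \<open>n + 1\<close>, cleared of denominators.\<close>

lemma cont_complete_quotient:
  "\<alpha> * (cont_den (cf_coeff \<alpha>) (Suc n) + cont_den (cf_coeff \<alpha>) n * cf_rem \<alpha> (Suc n))
     = cont_num (cf_coeff \<alpha>) (Suc n) + cont_num (cf_coeff \<alpha>) n * cf_rem \<alpha> (Suc n)"
proof (induction n)
  case 0
  show ?case using cf_rem_bounds(1)[of 0] by (simp add: field_simps)
next
  case (Suc n)
  define t where "t = cf_rem \<alpha> (Suc n)"
  have t: "t > 0" unfolding t_def by (rule cf_rem_bounds)
  define q q' p p' where "q = real_of_int (cont_den (cf_coeff \<alpha>) n)"
    and "q' = real_of_int (cont_den (cf_coeff \<alpha>) (Suc n))"
    and "p = real_of_int (cont_num (cf_coeff \<alpha>) n)"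
    and "p' = real_of_int (cont_num (cf_coeff \<alpha>) (Suc n))"
  have inverse_rem: "1 / t = cf_coeff \<alpha> (Suc (Suc n)) + cf_rem \<alpha> (Suc (Suc n))"
    by (simp add: t_def)
  have IH: "\<alpha> * (q' + q * t) = p' + p * t" using Suc by (simp add: q_def q'_def p_def p'_def t_def)
  \<comment> \<open>Dividing by \<open>t\<close> brings in \<open>1 / t\<close>, whose integer part
    is the next coefficient; the recurrences then apply.\<close>
  have "\<alpha> * (q' * (1 / t) + q) = \<alpha> * (q' + q * t) / t"
    using t by (simp add: field_simps)
  also have "\<dots> = p' * (1 / t) + p" unfolding IH using t by (simp add: field_simps)
  finally show ?case
    unfolding inverse_rem
    by (simp del: cf_rem.simps flip: t_def q_def q'_def p_def p'_def add: algebra_simps del: cf_coeff.simps)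
qed

text \<open>The complete quotient formula and the determinant give
  \<open>\<bar>\<alpha> * q - p\<bar> * (q' + q * t) = 1\<close>; dropping \<open>q * t\<close>
  gives the bound.\<close>

lemma convergent_approx:
  "\<bar>\<alpha> - cont_num (cf_coeff \<alpha>) n / cont_den (cf_coeff \<alpha>) n\<bar>
     \<le> 1 / (real_of_int (cf_denom \<alpha> n) * real_of_int (cf_denom \<alpha> (Suc n)))"
proof -
  define t where "t = cf_rem \<alpha> (Suc n)"
  have t: "t > 0" unfolding t_def by (rule cf_rem_bounds)
  define q q' p p' where "q = real_of_int (cont_den (cf_coeff \<alpha>) n)"
    and "q' = real_of_int (cont_den (cf_coeff \<alpha>) (Suc n))"
    and "p = real_of_int (cont_num (cf_coeff \<alpha>) n)"
    and "p' = real_of_int (cont_num (cf_coeff \<alpha>) (Suc n))"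
  have q: "q > 0" "q' > 0"
    unfolding q_def q'_def using cont_den_cf_coeff_pos by auto
  have *: "\<alpha> * (q' + q * t) = p' + p * t"
    using cont_complete_quotient[of n] by (simp add: q_def q'_def p_def p'_def t_def)
  have "p' * q - p * q' = (-1) ^ n"
    using arg_cong[OF cont_det[of "cf_coeff \<alpha>" n], of real_of_int]
    by (simp add: q_def q'_def p_def p'_def)
  moreover have "(\<alpha> * q - p) * (q' + q * t) = p' * q - p * q'"
  proof -
    have "(\<alpha> * q - p) * (q' + q * t) = q * (\<alpha> * (q' + q * t)) - p * (q' + q * t)"
      by (simp add: algebra_simps)
    then show ?thesis unfolding * by (simp add: algebra_simps)
  qed
  ultimately have "\<bar>(\<alpha> * q - p) * (q' + q * t)\<bar> = 1" by simp
  then have "\<bar>\<alpha> * q - p\<bar> * (q' + q * t) = 1"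
    using q t by (simp add: abs_mult)
  moreover have "\<bar>\<alpha> * q - p\<bar> * q' \<le> \<bar>\<alpha> * q - p\<bar> * (q' + q * t)"
    using q t by (intro mult_left_mono) auto
  ultimately have "\<bar>\<alpha> * q - p\<bar> * q' \<le> 1" by simp
  moreover have "\<bar>\<alpha> - p / q\<bar> = \<bar>\<alpha> * q - p\<bar> / q"
    using q by (simp add: field_simps abs_if)
  ultimately have "\<bar>\<alpha> - p / q\<bar> \<le> 1 / (q * q')" using q by (simp add: field_simps)
  then show ?thesis by (simp add: cf_denom_eq_cont p_def q_def q'_def)
qed

lemma cf_denom_pos: "cf_denom \<alpha> n > 0"
  unfolding cf_denom_eq_cont by (rule cont_den_cf_coeff_pos)

lemma cf_denom_Suc_Suc: "cf_denom \<alpha> (Suc (Suc n)) \<ge> cf_denom \<alpha> (Suc n) + cf_denom \<alpha> n"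
proof -
  have "cf_coeff \<alpha> (Suc (Suc n)) * cont_den (cf_coeff \<alpha>) (Suc n) \<ge> 1 * cont_den (cf_coeff \<alpha>) (Suc n)"
    using cf_coeff_pos[of "Suc (Suc n)"] cont_den_cf_coeff_pos[of "Suc n"]
    by (intro mult_right_mono) auto
  then show ?thesis by (simp add: cf_denom_eq_cont)
qed

lemma cf_denom_mono: "cf_denom \<alpha> n \<le> cf_denom \<alpha> (Suc n)"
proof (cases n)
  case 0
  then show ?thesis using cf_denom_pos[of "Suc 0"] cf_denom_eq_cont[of 0] by simp
next
  case (Suc m)
  then show ?thesis using cf_denom_Suc_Suc[of m] cf_denom_pos[of m] by simp
qed

text \<open>Denominators at least double every two steps. Squaring expresses the resulting growth
  like powers of the square root of 2 within the integers.\<close>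

lemma cf_denom_growth: "2 ^ n \<le> 2 * (cf_denom \<alpha> n)\<^sup>2"
proof (induction n rule: induct_nat_012)
  case 0
  show ?case using cf_denom_pos[of 0] by (simp add: cf_denom_eq_cont)
next
  case 1
  have "(cf_denom \<alpha> 1)\<^sup>2 \<ge> 1" using cf_denom_pos[of 1] by (simp add: power2_eq_square int_one_le_iff_zero_less)
  then show ?case by simp
next
  case (ge2 n)
  have "2 * cf_denom \<alpha> n \<le> cf_denom \<alpha> (Suc (Suc n))"
    using cf_denom_Suc_Suc[of n] cf_denom_mono[of n] by linarith
  then have "(2 * cf_denom \<alpha> n)\<^sup>2 \<le> (cf_denom \<alpha> (Suc (Suc n)))\<^sup>2"
    using cf_denom_pos[of n] by (intro power_mono) auto
  then show ?case using ge2(1) by (simp add: power2_eq_square)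
qed

end

subsection \<open>Covering the complement of the Brjuno set\<close>

lemma filterlim_at_top_of_growth:
  fixes Q :: "nat \<Rightarrow> real"
  assumes "\<And>n. Q n \<ge> 0" and "\<And>n. 2 ^ n \<le> 2 * (Q n)\<^sup>2"
  shows "filterlim Q at_top sequentially"
proof (rule filterlim_at_top_mono)
  show "filterlim (\<lambda>n::nat. sqrt (2 ^ n / 2)) at_top sequentially" by real_asymp
  have "sqrt (2 ^ n / 2) \<le> Q n" for n
    by (rule real_le_lsqrt) (use assms[of n] in auto)
  then show "\<forall>\<^sub>F n in sequentially. sqrt (2 ^ n / 2) \<le> Q n" by simp
qed

lemma summable_ln_quotient:
  fixes Q :: "nat \<Rightarrow> real"
  assumes ge1: "\<And>n. Q n \<ge> 1" and mono: "\<And>n. Q n \<le> Q (Suc n)"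
    and growth: "\<And>n. 2 ^ n \<le> 2 * (Q n)\<^sup>2"
    and slow: "\<forall>\<^sub>F n in sequentially. ln (Q (Suc n)) < Q n / sqrt (ln (Q n))"
  shows "summable (\<lambda>n. ln (Q (Suc n)) / Q n)"
proof -
  \<comment> \<open>The growth hypothesis bounds \<open>1 / (Q n)^2\<close> by
    \<open>2 * (1/2)^n\<close>; a fourth root turns this into a geometric bound for
    \<open>1 / sqrt (Q n)\<close> with ratio \<open>r\<close>.\<close>
  define r where "r = sqrt (sqrt (1 / 2 :: real))"
  have r: "0 < r" "r < 1" "r ^ 4 = 1 / 2"
    by (simp_all add: r_def power4_eq_xxxx mult.assoc)
  define u where "u n = 1 / sqrt (ln (Q n))" for n
  have pow4: "(sqrt x) ^ 4 = x\<^sup>2" if "x \<ge> 0" for x :: real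
    using that by (simp add: power4_eq_xxxx power2_eq_square)
  have inv_sqrt: "1 / sqrt (Q n) \<le> 2 * r ^ n" for n
  proof -
    have "(1 / sqrt (Q n)) ^ 4 = 1 / (Q n)\<^sup>2"
      using ge1[of n] by (simp add: power_divide pow4)
    also have "\<dots> \<le> 2 * (1 / 2) ^ n"
      using growth[of n] ge1[of n] by (simp add: field_simps power_divide)
    \<comment> \<open>The constant 2 is enlarged to 16, the fourth power of 2.\<close>
    also have "\<dots> \<le> 16 * (r ^ 4) ^ n" by (simp add: r)
    also have "\<dots> = (2 * r ^ n) ^ 4" by (simp add: power_mult_distrib flip: power_mult) (simp add: mult.commute)
    finally show ?thesis using r ge1[of n] by (subst (asm) power_mono_iff) auto
  qed
  have lim: "filterlim Q at_top sequentially"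
    using filterlim_at_top_of_growth[OF _ growth] ge1 by (meson order_trans zero_le_one)
  have "((\<lambda>x::real. 1 / sqrt (ln x)) \<longlongrightarrow> 0) at_top" by real_asymp
  then have u0: "u \<longlonglongrightarrow> 0" unfolding u_def by (rule filterlim_compose[OF _ lim])
  \<comment> \<open>The factor 4 makes \<open>sqrt (ln (Q n))\<close> at least double whenever
    \<open>ln (Q (Suc n))\<close> exceeds \<open>sqrt (Q n)\<close>.\<close>
  have "\<forall>\<^sub>F x in at_top. ln x > 0 \<and> 4 * ln x \<le> sqrt (x::real)"
    by (intro eventually_conj; real_asymp)
  then have "\<forall>\<^sub>F n in sequentially. ln (Q n) > 0 \<and> 4 * ln (Q n) \<le> sqrt (Q n)"
    using lim by (rule eventually_compose_filterlim)
  then have "\<forall>\<^sub>F n in sequentially.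
      norm (ln (Q (Suc n)) / Q n) \<le> 2 * r ^ n + 2 * (u n - u (Suc n))"
    using slow
  proof eventually_elim
    case (elim n)
    have Q: "Q n > 0" using ge1[of n] by simp
    have le: "ln (Q n) \<le> ln (Q (Suc n))" using mono[of n] Q by simp
    then have pos: "ln (Q (Suc n)) > 0" using elim by simp
    have "ln (Q (Suc n)) / Q n \<le> 2 * r ^ n + 2 * (u n - u (Suc n))"
    proof (cases "ln (Q (Suc n)) \<le> sqrt (Q n)")
      case True
      then have "ln (Q (Suc n)) / Q n \<le> sqrt (Q n) / Q n" using Q by (simp add: divide_right_mono)
      also have "\<dots> = 1 / sqrt (Q n)" using Q by (simp add: field_simps)
      also have "\<dots> \<le> 2 * r ^ n" by (rule inv_sqrt)
      finally have "ln (Q (Suc n)) / Q n \<le> 2 * r ^ n" .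
      moreover have "u (Suc n) \<le> u n" unfolding u_def using le elim by (intro divide_left_mono) auto
      ultimately show ?thesis by simp
    next
      case False
      with elim have "sqrt (4 * ln (Q n)) \<le> sqrt (ln (Q (Suc n)))" by simp
      then have "2 * sqrt (ln (Q n)) \<le> sqrt (ln (Q (Suc n)))" by (simp add: real_sqrt_mult)
      then have "u (Suc n) \<le> 1 / (2 * sqrt (ln (Q n)))"
        unfolding u_def using elim pos by (intro divide_left_mono) auto
      \<comment> \<open>As \<open>u\<close> at least halves here,
        \<open>u n \<le> 2 * (u n - u (Suc n))\<close>, and the slow growth hypothesis bounds the
        term by \<open>u n\<close>.\<close>
      then have "2 * u (Suc n) \<le> u n" by (simp add: u_def field_simps)
      moreover have "ln (Q (Suc n)) / Q n \<le> (Q n / sqrt (ln (Q n))) / Q n"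
        using elim Q by (intro divide_right_mono) auto
      then have "ln (Q (Suc n)) / Q n \<le> u n" using Q by (simp add: u_def)
      moreover have "0 \<le> r ^ n" using r by simp
      ultimately show ?thesis by argo
    qed
    then show ?case using pos Q by simp
  qed
  then show ?thesis
  proof (rule summable_comparison_test_ev)
    show "summable (\<lambda>n. 2 * r ^ n + 2 * (u n - u (Suc n)))"
      using r telescope_summable'[OF u0]
      by (intro summable_add summable_mult summable_geometric) auto
  qed
qed

text \<open>Cauchy condensation reduces the series to a multiple of the sum of
  \<open>n powr (-s)\<close>.\<close>

lemma summable_inverse_ln_powr:
  fixes s :: real
  assumes "s > 1"
  shows "summable (\<lambda>n. 1 / (real n * ln (real n) powr s))"
proof -
  \<comment> \<open>Condensation needs a decreasing sequence, but at \<open>n = 1\<close> the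
    original term is 0 by division by zero. The maximum with 1 repairs this and changes only
    finitely many terms.\<close>
  define f where "f n = 1 / (real n * max 1 (ln (real n)) powr s)" for n
  have "summable (\<lambda>n. 2 ^ n * f (2 ^ n))"
  proof (rule summable_comparison_test_ev)
    show "summable (\<lambda>n. ln 2 powr (- s) * real n powr (- s))"
      using assms by (intro summable_mult) (simp add: summable_real_powr_iff)
    show "\<forall>\<^sub>F n in sequentially. norm (2 ^ n * f (2 ^ n)) \<le> ln 2 powr (- s) * real n powr (- s)"
      using eventually_gt_at_top[of 0]
    proof eventually_elim
      case (elim n)
      have "2 ^ n * f (2 ^ n) = 1 / max 1 (real n * ln 2) powr s"
        by (simp add: f_def ln_realpow)
      also have "\<dots> \<le> 1 / (real n * ln 2) powr s"
        using elim assms by (intro divide_left_mono powr_mono2) auto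
      also have "\<dots> = ln 2 powr (- s) * real n powr (- s)"
        by (simp add: powr_mult powr_minus field_simps)
      finally show ?case by (simp add: f_def)
    qed
  qed
  moreover have "f (Suc m) \<le> f m" if "0 < m" for m
    unfolding f_def using that assms
    by (intro divide_left_mono mult_mono powr_mono2 mult_pos_pos max.mono) auto
  ultimately have "summable f"
    by (subst condensation_test) (auto simp: f_def)
  moreover have "\<forall>\<^sub>F n in sequentially. ln (real n) \<ge> 1" by real_asymp
  then have "\<forall>\<^sub>F n in sequentially. f n = 1 / (real n * ln (real n) powr s)"
    by eventually_elim (simp add: f_def max_def)
  then have "summable f \<longleftrightarrow> summable (\<lambda>n. 1 / (real n * ln (real n) powr s))"
    by (rule summable_cong)
  ultimately show ?thesis by simp
qed

section \<open>The balls around rationals and their gauge sum\<close>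

definition brjuno_diam :: "nat \<Rightarrow> real" where
  "brjuno_diam q = exp (- (real q / sqrt (ln (real q))))"

lemma brjuno_gauge_exp: "brjuno_gauge \<sigma> (exp (- x)) = x powr (-2) * ln x powr (-\<sigma>)"
  by (simp add: brjuno_gauge_def ln_div)

text \<open>With \<open>x = q / sqrt (ln q)\<close>, \<open>x powr (-2)\<close> is
  \<open>ln q / q^2\<close> and \<open>ln x\<close> is asymptotic to \<open>ln q\<close>. The gauge
  thus has order \<open>(ln q) powr (-1 - 2 * \<tau>) / q^2\<close>, and the prefactor has order
  \<open>q * (ln q) powr \<tau>\<close>.\<close>

lemma summable_gauge_brjuno_diam:
  assumes "\<tau> > 0"
  shows "summable (\<lambda>q. (2 * (real q * ln (real q) powr \<tau>) + 1) *
           brjuno_gauge (2 + 2 * \<tau>) (brjuno_diam q))"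
proof (rule summable_comparison_test_bigo)
  show "summable (\<lambda>q. norm (1 / (real q * ln (real q) powr (1 + \<tau>))))"
    using summable_inverse_ln_powr[of "1 + \<tau>"] assms by simp
  show "(\<lambda>q. (2 * (real q * ln (real q) powr \<tau>) + 1) * brjuno_gauge (2 + 2 * \<tau>) (brjuno_diam q))
     \<in> O(\<lambda>q. 1 / (real q * ln (real q) powr (1 + \<tau>)))"
    using assms unfolding brjuno_diam_def brjuno_gauge_exp by real_asymp
qed

lemma irrational_compl_brjuno_frequently_approx:
  assumes irr: "\<alpha> \<notin> \<rat>" and "\<alpha> \<notin> brjuno_set"
  shows "\<exists>\<^sub>F q in sequentially. \<exists>p::int. \<bar>\<alpha> - p / real q\<bar> < brjuno_diam q / 2"
proof -
  define Q where "Q n = real_of_int (cf_denom \<alpha> n)" for n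
  have ge1: "Q n \<ge> 1" for n using cf_denom_pos[OF irr, of n] by (simp add: Q_def)
  have mono: "Q n \<le> Q (Suc n)" for n using cf_denom_mono[OF irr, of n] by (simp add: Q_def)
  have growth: "2 ^ n \<le> 2 * (Q n)\<^sup>2" for n
  proof -
    have "real_of_int (2 ^ n) \<le> real_of_int (2 * (cf_denom \<alpha> n)\<^sup>2)"
      using cf_denom_growth[OF irr, of n] by (simp only: of_int_le_iff)
    then show ?thesis by (simp add: Q_def)
  qed
  have lim: "filterlim Q at_top sequentially"
    using filterlim_at_top_of_growth[OF _ growth] ge1 by (meson order_trans zero_le_one)
  have "\<not> summable (\<lambda>n. ln (Q (Suc (Suc n))) / Q (Suc n))"
    using assms by (simp add: brjuno_set_def Q_def)
  then have "\<not> summable (\<lambda>n. ln (Q (Suc n)) / Q n)"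
    \<comment> \<open>The Brjuno series starts with \<open>Q 1\<close> in the denominator; adding
      the term of index 0 does not affect convergence.\<close>
    using summable_Suc_iff[of "\<lambda>n. ln (Q (Suc n)) / Q n"] by simp
  then have "\<exists>\<^sub>F n in sequentially. Q n / sqrt (ln (Q n)) \<le> ln (Q (Suc n))"
    using summable_ln_quotient[OF ge1 mono growth] by (auto simp: frequently_def not_le)
  \<comment> \<open>Then \<open>1 / Q n < 1 / 2\<close>, which yields a strict inequality with the
    radius, half the diameter.\<close>
  moreover have "\<forall>\<^sub>F n in sequentially. Q n \<ge> 3"
    using lim by (simp add: filterlim_at_top)
  ultimately have "\<exists>\<^sub>F n in sequentially. 3 \<le> Q n \<and> Q n / sqrt (ln (Q n)) \<le> ln (Q (Suc n))"
    by (rule frequently_eventually_conj)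
  then have "\<exists>\<^sub>F n in sequentially.
      \<exists>p::int. \<bar>\<alpha> - p / real (nat (cf_denom \<alpha> n))\<bar> < brjuno_diam (nat (cf_denom \<alpha> n)) / 2"
  proof (rule frequently_elim1, elim conjE)
    fix n assume "3 \<le> Q n" and ge: "Q n / sqrt (ln (Q n)) \<le> ln (Q (Suc n))"
    have nat: "real (nat (cf_denom \<alpha> n)) = Q n"
      using cf_denom_pos[OF irr, of n] by (simp add: Q_def)
    have "\<bar>\<alpha> - cont_num (cf_coeff \<alpha>) n / Q n\<bar> \<le> 1 / (Q n * Q (Suc n))"
      using convergent_approx[OF irr, of n] by (simp add: Q_def cf_denom_eq_cont[OF irr])
    also have "\<dots> \<le> 1 / (3 * Q (Suc n))"
      using \<open>3 \<le> Q n\<close> ge1[of "Suc n"] by (intro divide_left_mono mult_right_mono) auto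
    also have "\<dots> < (1 / Q (Suc n)) / 2" using ge1[of "Suc n"] by (simp add: field_simps)
    also have "1 / Q (Suc n) = exp (- ln (Q (Suc n)))"
      using ge1[of "Suc n"] by (simp add: exp_minus field_simps)
    also have "\<dots> \<le> brjuno_diam (nat (cf_denom \<alpha> n))"
      using ge by (simp add: brjuno_diam_def nat)
    finally show "\<exists>p::int. \<bar>\<alpha> - p / real (nat (cf_denom \<alpha> n))\<bar> < brjuno_diam (nat (cf_denom \<alpha> n)) / 2"
      unfolding nat by auto
  qed
  \<comment> \<open>Infinitely many indices \<open>n\<close> yield infinitely many denominators
    \<open>q\<close> because the denominators tend to infinity.\<close>
  moreover have "filterlim (\<lambda>n. nat (cf_denom \<alpha> n)) at_top sequentially"
  proof (rule iffD2[OF filterlim_sequentially_iff_filterlim_real])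
    have "(\<lambda>n. real (nat (cf_denom \<alpha> n))) = Q"
      using cf_denom_pos[OF irr] by (auto simp: Q_def less_imp_le)
    then show "filterlim (\<lambda>n. real (nat (cf_denom \<alpha> n))) at_top sequentially" using lim by simp
  qed
  ultimately show ?thesis
    unfolding frequently_def using eventually_compose_filterlim by fastforce
qed

lemma rational_frequently_approx:
  assumes "\<alpha> \<in> \<rat>"
  shows "\<exists>\<^sub>F q in sequentially. \<exists>p::int. \<bar>\<alpha> - p / real q\<bar> < brjuno_diam q / 2"
  unfolding frequently_sequentially
proof
  fix N :: nat
  obtain a b :: int where ab: "b > 0" "\<alpha> = a / b" using assms by (auto elim!: Rats_cases')
  have "N \<le> nat b * Suc N" using ab by (cases "nat b") auto
  moreover have "\<alpha> = (a * int (Suc N)) / real (nat b * Suc N)"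
  proof -
    have "real_of_int b * real (Suc N) \<noteq> 0" using ab by (simp del: of_nat_Suc)
    then show ?thesis using ab by (simp add: field_simps)
  qed
  then have "\<bar>\<alpha> - (a * int (Suc N)) / real (nat b * Suc N)\<bar> < brjuno_diam (nat b * Suc N) / 2"
    by (simp add: brjuno_diam_def)
  ultimately show "\<exists>q\<ge>N. \<exists>p::int. \<bar>\<alpha> - p / real q\<bar> < brjuno_diam q / 2" by blast
qed

text \<open>Once the error is below 1,
  \<open>\<bar>p\<bar> \<le> q * (\<bar>\<alpha>\<bar> + 1)\<close>, and
  \<open>(ln q) powr \<tau>\<close> eventually exceeds \<open>\<bar>\<alpha>\<bar> + 1\<close>. So
  the finite set of numerators allowed for each \<open>q\<close> does not depend on
  \<open>\<alpha>\<close>.\<close>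

lemma compl_brjuno_frequently_approx:
  assumes "\<alpha> \<notin> brjuno_set" and "\<tau> > 0"
  shows "\<exists>\<^sub>F q in sequentially. \<exists>p::int.
    \<bar>real_of_int p\<bar> \<le> real q * ln (real q) powr \<tau> \<and> \<bar>\<alpha> - p / real q\<bar> < brjuno_diam q / 2"
proof -
  have "\<exists>\<^sub>F q in sequentially. \<exists>p::int. \<bar>\<alpha> - p / real q\<bar> < brjuno_diam q / 2"
    using irrational_compl_brjuno_frequently_approx rational_frequently_approx assms by blast
  moreover have "\<forall>\<^sub>F q in sequentially. brjuno_diam q < 2"
    unfolding brjuno_diam_def by real_asymp
  moreover have "filterlim (\<lambda>q::nat. ln (real q) powr \<tau>) at_top sequentially"
    using assms by real_asymp
  then have "\<forall>\<^sub>F q::nat in sequentially. \<bar>\<alpha>\<bar> + 1 \<le> ln (real q) powr \<tau>"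
    by (simp add: filterlim_at_top)
  moreover have "\<forall>\<^sub>F q::nat in sequentially. q > 0" by (rule eventually_gt_at_top)
  ultimately show ?thesis
  proof (elim frequently_rev_mp, eventually_elim, safe)
    fix q and p :: int
    assume q: "brjuno_diam q < 2" "\<bar>\<alpha>\<bar> + 1 \<le> ln (real q) powr \<tau>" "0 < q"
      and p: "\<bar>\<alpha> - p / real q\<bar> < brjuno_diam q / 2"
    have "\<bar>real_of_int p\<bar> = real q * \<bar>p / real q\<bar>" using q by (simp add: abs_divide)
    also have "\<dots> \<le> real q * (\<bar>\<alpha>\<bar> + 1)" using q p by (intro mult_left_mono; linarith)
    also have "\<dots> \<le> real q * ln (real q) powr \<tau>" using q by (intro mult_left_mono) auto
    finally show "\<exists>p::int. \<bar>real_of_int p\<bar> \<le> real q * ln (real q) powr \<tau> \<and>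
        \<bar>\<alpha> - p / real q\<bar> < brjuno_diam q / 2" using p by blast
  qed
qed

lemma brjuno_gauge_nonneg: "brjuno_gauge \<sigma> t \<ge> 0"
  by (simp add: brjuno_gauge_def)

lemma finite_card_int_abs_le:
  assumes "x \<ge> 0"
  shows "finite {p::int. \<bar>real_of_int p\<bar> \<le> x}" "real (card {p::int. \<bar>real_of_int p\<bar> \<le> x}) \<le> 2 * x + 1"
proof -
  have *: "{p::int. \<bar>real_of_int p\<bar> \<le> x} = {- \<lfloor>x\<rfloor>..\<lfloor>x\<rfloor>}" by (auto; linarith)
  show "finite {p::int. \<bar>real_of_int p\<bar> \<le> x}" unfolding * by simp
  show "real (card {p::int. \<bar>real_of_int p\<bar> \<le> x}) \<le> 2 * x + 1"
    unfolding * using assms by simp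
qed

text \<open>A tail of the family of balls serves. The gauge is taken at the diameter, as the
  capacity bound requires, and finite subsums suit both compact sets and infinite sums.\<close>

lemma compl_brjuno_cover:
  assumes "\<sigma> > 2" "e > 0" "d > 0"
  shows "\<exists>(I :: nat set) c r. (\<forall>j\<in>I. 0 < r j \<and> r j < d) \<and>
    - brjuno_set \<subseteq> (\<Union>j\<in>I. ball (c j) (r j)) \<and>
    (\<forall>F. finite F \<longrightarrow> F \<subseteq> I \<longrightarrow> (\<Sum>j\<in>F. brjuno_gauge \<sigma> (2 * r j)) \<le> e)"
proof -
  define \<tau> where "\<tau> = (\<sigma> - 2) / 2"
  have "\<tau> > 0" and \<sigma>: "\<sigma> = 2 + 2 * \<tau>" using assms by (simp_all add: \<tau>_def field_simps)
  define P where "P q = {p::int. \<bar>real_of_int p\<bar> \<le> real q * ln (real q) powr \<tau>}" for q :: nat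
  define b where "b q = (2 * (real q * ln (real q) powr \<tau>) + 1) * brjuno_gauge \<sigma> (brjuno_diam q)" for q
  have card_P: "finite (P q)" "card (P q) * brjuno_gauge \<sigma> (brjuno_diam q) \<le> b q" for q
    unfolding P_def b_def using finite_card_int_abs_le[of "real q * ln (real q) powr \<tau>"]
    by (auto intro: mult_right_mono brjuno_gauge_nonneg)
  have "summable b"
    unfolding b_def \<sigma> by (rule summable_gauge_brjuno_diam) fact
  then obtain N1 where N1: "norm (sum b {m..<n}) < e" if "m \<ge> N1" for m n
    using \<open>e > 0\<close> unfolding summable_Cauchy by meson
  have "brjuno_diam \<longlonglongrightarrow> 0" unfolding brjuno_diam_def by real_asymp
  then have "\<forall>\<^sub>F q in sequentially. brjuno_diam q < d" using \<open>d > 0\<close> by (rule order_tendstoD)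
  then obtain N2 where N2: "brjuno_diam q < d" if "q \<ge> N2" for q
    by (auto simp: eventually_sequentially)
  \<comment> \<open>Beyond \<open>N1\<close> every block of the series is below \<open>e\<close>;
    beyond \<open>N2\<close> the balls are small enough.\<close>
  define N where "N = max N1 N2"
  define D where "D = Sigma {N..} P"
  define c where "c j = (case from_nat j of (q :: nat, p :: int) \<Rightarrow> p / real q)" for j
  define r where "r j = brjuno_diam (fst (from_nat j :: nat \<times> int)) / 2" for j
  show ?thesis
  proof (intro exI conjI ballI allI impI)
    show "0 < r j" "r j < d" if j: "j \<in> to_nat ` D" for j
    proof -
      obtain q and p :: int where "j = to_nat (q, p)" "q \<ge> N" using j unfolding D_def by blast
      then have "brjuno_diam q < d" "r j = brjuno_diam q / 2" "0 < brjuno_diam q"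
        using N2[of q] by (auto simp: N_def r_def brjuno_diam_def)
      then show "0 < r j" "r j < d" by auto
    qed
    show "- brjuno_set \<subseteq> (\<Union>j\<in>to_nat ` D. ball (c j) (r j))"
    proof
      fix \<alpha> assume "\<alpha> \<in> - brjuno_set"
      then obtain q p where "q \<ge> N" "p \<in> P q" "\<bar>\<alpha> - p / real q\<bar> < brjuno_diam q / 2"
        using compl_brjuno_frequently_approx[OF _ \<open>\<tau> > 0\<close>, of \<alpha>]
        unfolding frequently_sequentially P_def by blast
      then have "(q, p) \<in> D" "\<alpha> \<in> ball (c (to_nat (q, p))) (r (to_nat (q, p)))"
        by (auto simp: D_def c_def r_def dist_real_def abs_minus_commute)
      then show "\<alpha> \<in> (\<Union>j\<in>to_nat ` D. ball (c j) (r j))" by blast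
    qed
    fix F assume F: "finite F" "F \<subseteq> to_nat ` D"
    define G where "G = (from_nat ` F :: (nat \<times> int) set)"
    have G: "finite G" "G \<subseteq> D" "F = to_nat ` G" using F by (force simp: G_def image_image)+
    \<comment> \<open>A finite subfamily involves only denominators in some block from
      \<open>N\<close> to \<open>M\<close>, so its sum is bounded by that of the block.\<close>
    have "finite (fst ` G)" using G by simp
    then obtain M where "fst ` G \<subseteq> {..<M}" by (metis finite_nat_iff_bounded)
    then have GM: "G \<subseteq> Sigma {N..<M} P" using G by (force simp: D_def)
    have "(\<Sum>j\<in>F. brjuno_gauge \<sigma> (2 * r j)) = (\<Sum>x\<in>G. brjuno_gauge \<sigma> (brjuno_diam (fst x)))"
      unfolding G(3) by (subst sum.reindex) (auto simp: r_def inj_on_def)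
    also have "\<dots> \<le> (\<Sum>x\<in>Sigma {N..<M} P. brjuno_gauge \<sigma> (brjuno_diam (fst x)))"
      using GM card_P by (intro sum_mono2 brjuno_gauge_nonneg finite_SigmaI) auto
    also have "\<dots> = (\<Sum>q\<in>{N..<M}. \<Sum>p\<in>P q. brjuno_gauge \<sigma> (brjuno_diam q))"
      by (subst sum.Sigma) (auto simp: card_P split_def)
    also have "\<dots> \<le> sum b {N..<M}" using card_P by (simp add: sum_mono)
    also have "\<dots> \<le> e" using N1[of N M] by (simp add: N_def)
    finally show "(\<Sum>j\<in>F. brjuno_gauge \<sigma> (2 * r j)) \<le> e" .
  qed
qed

subsection \<open>Capacity and Hausdorff measure\<close>

text \<open>Only the diagonal blocks \<open>A j \<times> A j\<close> are kept; the nonnegative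
  interactions between different pieces are discarded.\<close>

lemma mutual_energy_ge:
  fixes n :: nat
  assumes "finite_measure \<mu>" and sets: "sets \<mu> = sets borel"
    and A: "\<And>j. A j \<in> sets borel" "disjoint_family_on A {..<n}" "\<And>j. j < n \<Longrightarrow> A j \<subseteq> K"
    and k: "\<And>j z \<xi>. j < n \<Longrightarrow> z \<in> A j \<Longrightarrow> \<xi> \<in> A j \<Longrightarrow> ennreal (c j) \<le> k z \<xi>"
    and c: "\<And>j. j < n \<Longrightarrow> c j \<ge> 0"
  shows "ennreal (\<Sum>j<n. c j * (measure \<mu> (A j))\<^sup>2)
           \<le> (\<integral>\<^sup>+z\<in>K. (\<integral>\<^sup>+\<xi>\<in>K. k z \<xi> \<partial>\<mu>) \<partial>\<mu>)"
proof -
  interpret finite_measure \<mu> by fact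
  have A_sets [measurable]: "A j \<in> sets \<mu>" for j using A sets by simp
  have "ennreal (\<Sum>j<n. c j * (measure \<mu> (A j))\<^sup>2)
      = (\<Sum>j<n. ennreal (c j) * emeasure \<mu> (A j) * emeasure \<mu> (A j))"
  proof (subst sum_ennreal [symmetric])
    show "(\<Sum>j<n. ennreal (c j * (measure \<mu> (A j))\<^sup>2))
        = (\<Sum>j<n. ennreal (c j) * emeasure \<mu> (A j) * emeasure \<mu> (A j))"
      using c by (intro sum.cong) (auto simp: emeasure_eq_measure ennreal_mult power2_eq_square mult.assoc)
  qed (use c in auto)
  also have "\<dots> = (\<integral>\<^sup>+z. (\<Sum>j<n. ennreal (c j) * emeasure \<mu> (A j) * indicator (A j) z) \<partial>\<mu>)"
    by (subst nn_integral_sum) (auto simp: nn_integral_cmult)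
  also have "\<dots> \<le> (\<integral>\<^sup>+z\<in>K. (\<integral>\<^sup>+\<xi>\<in>K. k z \<xi> \<partial>\<mu>) \<partial>\<mu>)"
  proof (rule nn_integral_mono)
    fix z
    show "(\<Sum>j<n. ennreal (c j) * emeasure \<mu> (A j) * indicator (A j) z)
      \<le> (\<integral>\<^sup>+\<xi>\<in>K. k z \<xi> \<partial>\<mu>) * indicator K z"
    proof (cases "\<exists>i<n. z \<in> A i")
      case True
      then obtain i where i: "i < n" "z \<in> A i" by blast
      \<comment> \<open>By disjointness only the piece containing \<open>z\<close>
        contributes.\<close>
      have "(\<Sum>j<n. ennreal (c j) * emeasure \<mu> (A j) * indicator (A j) z)
          = (\<Sum>j\<in>{i}. ennreal (c j) * emeasure \<mu> (A j) * indicator (A j) z)"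
        using i A(2) by (intro sum.mono_neutral_right finite_lessThan) (auto simp: disjoint_family_on_def indicator_def)
      also have "\<dots> = (\<integral>\<^sup>+\<xi>. ennreal (c i) * indicator (A i) \<xi> \<partial>\<mu>)"
        using i by (simp add: nn_integral_cmult)
      also have "\<dots> \<le> (\<integral>\<^sup>+\<xi>\<in>K. k z \<xi> \<partial>\<mu>)"
        using i k A(3)[OF i(1)] by (intro nn_integral_mono) (auto simp: indicator_def)
      finally show ?thesis using i A(3)[OF i(1)] by (simp add: subsetD)
    qed (auto simp: indicator_def)
  qed
  finally show ?thesis .
qed

lemma inverse_ennreal_antimono:
  fixes a b :: ennreal
  assumes "a \<le> b"
  shows "inverse b \<le> inverse a"
proof (cases "a = 0 \<or> b = top")
  case False
  then obtain x y where "a = ennreal x" "b = ennreal y" "0 < x" "0 < y"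
    using assms by (cases a; cases b) (auto simp: less_le top_unique)
  then show ?thesis using assms by (simp add: inverse_ennreal ennreal_leI le_imp_inverse_le)
qed auto

text \<open>By the Cauchy--Schwarz inequality, masses \<open>m\<^sub>j\<close> of total mass 1 on disjoint pieces of the
  sets \<open>B\<^sub>j\<close> satisfy \<open>\<Sum>\<^sub>j m\<^sub>j\<^sup>2 / w\<^sub>j \<ge> 1 / \<Sum>\<^sub>j w\<^sub>j\<close>.\<close>

lemma compact_capacity_le_sum:
  fixes n :: nat
  assumes "compact K" and K: "K \<subseteq> (\<Union>j<n. B j)" and B: "\<And>j. B j \<in> sets borel"
    and k: "\<And>j z \<xi>. j < n \<Longrightarrow> z \<in> B j \<Longrightarrow> \<xi> \<in> B j \<Longrightarrow> ennreal (1 / w j) \<le> k z \<xi>"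
    and w: "\<And>j. j < n \<Longrightarrow> w j > 0"
  shows "compact_capacity k K \<le> ennreal (\<Sum>j<n. w j)"
proof (cases "n = 0")
  case True
  \<comment> \<open>Here \<open>K\<close> is empty, so the energy is the infimum of the empty set,
    which is infinite.\<close>
  then have "prob_measures_on K = {}"
    using K by (auto simp: prob_measures_on_def dest!: prob_space.emeasure_space_1 dest: sets_eq_imp_space_eq)
  then show ?thesis by (simp add: compact_capacity_def min_energy_def)
next
  case False
  define W where "W = (\<Sum>j<n. w j)"
  have "W > 0" unfolding W_def using w False by (intro sum_pos) auto
  have K_borel: "K \<in> sets borel" using \<open>compact K\<close> by (simp add: borel_compact)
  have "ennreal (1 / W) \<le> (\<integral>\<^sup>+z\<in>K. (\<integral>\<^sup>+\<xi>\<in>K. k z \<xi> \<partial>\<mu>) \<partial>\<mu>)"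
    if "\<mu> \<in> prob_measures_on K" for \<mu>
  proof -
    have \<mu>: "prob_space \<mu>" "sets \<mu> = sets borel" "emeasure \<mu> (- K) = 0"
      using that by (auto simp: prob_measures_on_def)
    interpret prob_space \<mu> by fact
    have space: "space \<mu> = UNIV" using \<mu>(2) sets_eq_imp_space_eq by fastforce
    \<comment> \<open>Cutting the sets into disjoint pieces of \<open>K\<close> makes their masses
      add up to exactly 1.\<close>
    define A where "A = disjointed (\<lambda>j. B j \<inter> K)"
    have A_sets: "A j \<in> sets borel" for j
      using sets.range_disjointed_sets[of "\<lambda>j. B j \<inter> K" borel] B K_borel by (auto simp: A_def)
    have A_sub: "A j \<subseteq> B j" "A j \<subseteq> K" for j
      using disjointed_subset[of "\<lambda>j. B j \<inter> K" j] by (auto simp: A_def)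
    have A_disj: "disjoint_family_on A {..<n}"
      using disjoint_family_disjointed[of "\<lambda>j. B j \<inter> K"]
      by (auto simp: A_def disjoint_family_on_def)
    have A_UN: "(\<Union>j<n. A j) = K"
      using K by (auto simp: A_def finite_UN_disjointed_eq lessThan_atLeast0)
    have "measure \<mu> K = 1"
      using \<mu> K_borel prob_compl[of K] by (simp add: space measure_def Compl_eq_Diff_UNIV)
    then have one: "(\<Sum>j<n. measure \<mu> (A j)) = 1"
      using finite_measure_finite_Union[of "{..<n}" A] A_sets A_disj \<mu>(2) by (auto simp: A_UN)
    have "(\<Sum>j<n. sqrt (w j) * (measure \<mu> (A j) / sqrt (w j)))\<^sup>2
        \<le> (\<Sum>j<n. (sqrt (w j))\<^sup>2) * (\<Sum>j<n. (measure \<mu> (A j) / sqrt (w j))\<^sup>2)"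
      by (rule Cauchy_Schwarz_ineq_sum)
    also have "(\<Sum>j<n. sqrt (w j) * (measure \<mu> (A j) / sqrt (w j))) = 1"
      using w one by (simp add: less_imp_neq[symmetric])
    also have "(\<Sum>j<n. (sqrt (w j))\<^sup>2) = W"
      unfolding W_def using w by (intro sum.cong) (auto simp: less_imp_le)
    also have "(\<Sum>j<n. (measure \<mu> (A j) / sqrt (w j))\<^sup>2) = (\<Sum>j<n. 1 / w j * (measure \<mu> (A j))\<^sup>2)"
      using w by (intro sum.cong) (auto simp: less_imp_le power_divide)
    finally have "1 / W \<le> (\<Sum>j<n. 1 / w j * (measure \<mu> (A j))\<^sup>2)"
      using \<open>W > 0\<close> by (simp add: field_simps)
    then have "ennreal (1 / W) \<le> ennreal (\<Sum>j<n. 1 / w j * (measure \<mu> (A j))\<^sup>2)"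
      by (rule ennreal_leI)
    also have "\<dots> \<le> (\<integral>\<^sup>+z\<in>K. (\<integral>\<^sup>+\<xi>\<in>K. k z \<xi> \<partial>\<mu>) \<partial>\<mu>)"
    proof (rule mutual_energy_ge)
      show "ennreal (1 / w j) \<le> k z \<xi>" if "j < n" "z \<in> A j" "\<xi> \<in> A j" for j z \<xi>
        using that k A_sub by blast
    qed (use A_sets A_disj A_sub \<mu> w in \<open>auto intro: finite_measure_axioms less_imp_le\<close>)
    finally show ?thesis .
  qed
  then have "ennreal (1 / W) \<le> min_energy k K"
    unfolding min_energy_def by (rule INF_greatest)
  then have "inverse (min_energy k K) \<le> inverse (ennreal (1 / W))"
    by (rule inverse_ennreal_antimono)
  also have "\<dots> = ennreal W" using \<open>W > 0\<close> by (simp add: inverse_ennreal)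
  finally show ?thesis by (simp add: compact_capacity_def W_def)
qed

text \<open>For \<open>s < t\<close> both logarithmic factors of the kernel dominate those at
  \<open>t\<close>, since \<open>ln (e + 1/s) \<ge> ln (1/t)\<close>. The bound on \<open>t\<close>
  gives \<open>ln (1/t) > 1\<close>, so the iterated logarithm is positive.\<close>

lemma brjuno_kernel_ge:
  assumes "0 < t" "t < exp (-1)" "cmod (z - \<xi>) < t" "\<sigma> \<ge> 0"
  shows "ennreal (1 / brjuno_gauge \<sigma> t) \<le> brjuno_kernel \<sigma> z \<xi>"
proof (cases "z = \<xi>")
  case False
  define s where "s = cmod (z - \<xi>)"
  have s: "0 < s" "s < t" using False assms by (auto simp: s_def)
  have L: "1 < - ln t" "- ln t \<le> - ln s" using assms s ln_less_cancel_iff[of t "exp (-1)"] by auto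
  have "- ln s = ln (1 / s)" using s by (simp add: ln_div)
  also have "\<dots> \<le> ln (exp 1 + 1 / s)" using s by (intro ln_mono) (auto intro: add_pos_pos)
  finally have "- ln t \<le> ln (exp 1 + 1 / s)" using L by linarith
  then have "ln (- ln t) \<le> ln (ln (exp 1 + 1 / s))" using L by (intro ln_mono) auto
  then have "ln (- ln t) powr \<sigma> \<le> \<bar>ln (ln (exp 1 + 1 / s))\<bar> powr \<sigma>"
    using L assms by (intro powr_mono2) auto
  moreover have "(- ln t)\<^sup>2 \<le> (- ln s)\<^sup>2" using L by (intro power_mono) auto
  ultimately have "(- ln t)\<^sup>2 * ln (- ln t) powr \<sigma> \<le> (ln s)\<^sup>2 * \<bar>ln (ln (exp 1 + 1 / s))\<bar> powr \<sigma>"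
    by (intro mult_mono) auto
  moreover have "(- ln t) powr 2 = (ln t)\<^sup>2" using L powr_numeral[of "- ln t" "num.Bit0 num.One"] by simp
  then have "1 / brjuno_gauge \<sigma> t = (- ln t)\<^sup>2 * ln (- ln t) powr \<sigma>"
    using assms L by (simp add: brjuno_gauge_def ln_div powr_minus field_simps)
  ultimately show ?thesis
    using False by (simp add: brjuno_kernel_def s_def ennreal_leI)
qed (simp add: brjuno_kernel_def)

lemma brjuno_gauge_pos: "0 < t \<Longrightarrow> t < exp (-1) \<Longrightarrow> brjuno_gauge \<sigma> t > 0"
  using ln_less_cancel_iff[of t "exp (-1)"] ln_gt_zero[of "- ln t"]
  by (auto simp add: brjuno_gauge_def ln_div zero_less_mult_iff)

text \<open>Serves to replace diameters by radii in the Hausdorff sums.\<close>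

lemma brjuno_gauge_mono:
  assumes "0 < s" "s \<le> t" "t < exp (-1)" "\<sigma> \<ge> 0"
  shows "brjuno_gauge \<sigma> s \<le> brjuno_gauge \<sigma> t"
proof -
  have L: "1 < - ln t" "- ln t \<le> - ln s" using assms ln_less_cancel_iff[of t "exp (-1)"] by auto
  have "(- ln s) powr -2 \<le> (- ln t) powr -2" using L by (intro powr_mono2') auto
  moreover have "ln (- ln s) powr -\<sigma> \<le> ln (- ln t) powr -\<sigma>"
    using L assms ln_gt_zero[of "- ln t"] ln_mono[of "- ln t" "- ln s"]
    by (intro powr_mono2') linarith+
  ultimately have "(- ln s) powr -2 * ln (- ln s) powr -\<sigma> \<le> (- ln t) powr -2 * ln (- ln t) powr -\<sigma>"
    by (intro mult_mono) auto
  then show ?thesis using assms by (simp add: brjuno_gauge_def ln_div)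
qed

text \<open>A compact subset meets the bound for finite covers after passing to a finite
  subcover.\<close>

lemma inner_capacity_UN_le:
  fixes k :: "complex \<Rightarrow> complex \<Rightarrow> ennreal"
  assumes "\<And>j. j \<in> I \<Longrightarrow> open (B j)"
    and k: "\<And>j z \<xi>. j \<in> I \<Longrightarrow> z \<in> B j \<Longrightarrow> \<xi> \<in> B j \<Longrightarrow> ennreal (1 / w j) \<le> k z \<xi>"
    and w: "\<And>j. j \<in> I \<Longrightarrow> w j > 0"
    and sum: "\<And>F. finite F \<Longrightarrow> F \<subseteq> I \<Longrightarrow> (\<Sum>j\<in>F. w j) \<le> e"
  shows "inner_capacity k (\<Union>j\<in>I. B j) \<le> ennreal e"
  unfolding inner_capacity_def
proof (rule SUP_least, elim CollectE conjE)
  fix K assume K: "compact K" "K \<subseteq> (\<Union>j\<in>I. B j)"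
  obtain F where F: "F \<subseteq> I" "finite F" "K \<subseteq> (\<Union>j\<in>F. B j)"
    using compactE_image[OF K(1) assms(1) K(2)] by metis
  obtain h n where h: "bij_betw h {..<n::nat} F"
    using ex_bij_betw_nat_finite[OF F(2)] by (auto simp: lessThan_atLeast0)
  then have hI: "h i \<in> I" if "i < n" for i using F(1) that by (auto simp: bij_betw_def)
  \<comment> \<open>Padding with empty sets makes \<open>B' i\<close> Borel for every
    \<open>i\<close>, as the bound for finite covers demands.\<close>
  define B' where "B' i = (if i < n then B (h i) else {})" for i
  have "compact_capacity k K \<le> ennreal (\<Sum>i<n. w (h i))"
  proof (rule compact_capacity_le_sum[OF K(1)])
    show "K \<subseteq> (\<Union>i<n. B' i)" using F(3) h by (auto simp: B'_def bij_betw_def)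
    show "B' i \<in> sets borel" for i
      using assms(1)[OF hI] by (auto simp: B'_def)
  qed (use k w hI in \<open>auto simp: B'_def\<close>)
  also have "(\<Sum>i<n. w (h i)) = (\<Sum>j\<in>F. w j)" using h by (rule sum.reindex_bij_betw)
  also have "ennreal \<dots> \<le> ennreal e" using sum F by (intro ennreal_leI) auto
  finally show "compact_capacity k K \<le> ennreal e" .
qed

section \<open>Vanishing of the outer capacity and of the Hausdorff measure\<close>

lemma ennreal_eq_0_if_le_pos:
  fixes x :: ennreal
  assumes "\<And>e. e > 0 \<Longrightarrow> x \<le> ennreal e"
  shows "x = 0"
proof -
  have "x \<le> 0" by (rule ennreal_le_epsilon) (use assms in auto)
  then show ?thesis by simp
qed

lemma outer_capacity_compl_brjuno:
  assumes "\<sigma> > 2"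
  shows "outer_capacity (brjuno_kernel \<sigma>) (complex_of_real ` (- brjuno_set)) = 0"
proof (rule ennreal_eq_0_if_le_pos)
  fix e :: real assume "e > 0"
  \<comment> \<open>Radii below this have doubles below \<open>exp (-1)\<close>, the range of the
    kernel comparison.\<close>
  have "exp (-1) / 2 > (0 :: real)" by simp
  from compl_brjuno_cover[OF assms \<open>e > 0\<close> this]
  obtain I :: "nat set" and c r where cov: "\<forall>j\<in>I. 0 < r j \<and> r j < exp (-1) / 2"
    "- brjuno_set \<subseteq> (\<Union>j\<in>I. ball (c j) (r j))"
    "\<forall>F. finite F \<longrightarrow> F \<subseteq> I \<longrightarrow> (\<Sum>j\<in>F. brjuno_gauge \<sigma> (2 * r j)) \<le> e"
    by (elim exE conjE)
  \<comment> \<open>The real intervals are replaced by complex discs with the same centres and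
    radii.\<close>
  define U where "U = (\<Union>j\<in>I. ball (complex_of_real (c j)) (r j))"
  have "complex_of_real ` (- brjuno_set) \<subseteq> U"
  proof (intro image_subsetI)
    fix x assume "x \<in> - brjuno_set"
    then obtain j where "j \<in> I" "x \<in> ball (c j) (r j)" using cov(2) by blast
    then show "complex_of_real x \<in> U"
      by (auto simp: U_def dist_norm simp flip: of_real_diff)
  qed
  moreover have "open U" unfolding U_def by auto
  ultimately have "outer_capacity (brjuno_kernel \<sigma>) (complex_of_real ` (- brjuno_set))
      \<le> inner_capacity (brjuno_kernel \<sigma>) U"
    unfolding outer_capacity_def by (intro INF_lower) auto
  also have "\<dots> \<le> ennreal e" unfolding U_def
  proof (rule inner_capacity_UN_le[where w = "\<lambda>j. brjuno_gauge \<sigma> (2 * r j)"])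
    fix j z \<xi>
    assume j: "j \<in> I" and z: "z \<in> ball (complex_of_real (c j)) (r j)" "\<xi> \<in> ball (complex_of_real (c j)) (r j)"
    have "cmod (z - \<xi>) < 2 * r j"
      using z dist_triangle_half_r[of "complex_of_real (c j)" z "2 * r j" \<xi>] by (simp add: dist_norm)
    then show "ennreal (1 / brjuno_gauge \<sigma> (2 * r j)) \<le> brjuno_kernel \<sigma> z \<xi>"
      using bspec[OF cov(1) j] assms by (intro brjuno_kernel_ge) auto
  next
    show "brjuno_gauge \<sigma> (2 * r j) > 0" if "j \<in> I" for j
      using bspec[OF cov(1) that] by (intro brjuno_gauge_pos) auto
  qed (use cov in auto)
  finally show "outer_capacity (brjuno_kernel \<sigma>) (complex_of_real ` (- brjuno_set)) \<le> ennreal e" .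
qed

lemma inner_capacity_le_outer: "inner_capacity k E \<le> outer_capacity k E"
  unfolding outer_capacity_def inner_capacity_def
  by (intro INF_greatest SUP_subset_mono) auto

text \<open>The infimum already vanishes at each scale \<open>\<epsilon>\<close>, as covers of
  arbitrarily small gauge sum exist with radii below any bound.\<close>

lemma hausdorff_pre_compl_brjuno:
  assumes "\<sigma> > 2" "0 < \<epsilon>"
  shows "hausdorff_pre (brjuno_gauge \<sigma>) \<epsilon> (- brjuno_set) = 0"
proof (rule ennreal_eq_0_if_le_pos)
  fix e :: real assume "e > 0"
  define d where "d = min \<epsilon> (exp (-1) / 2)"
  have "d > 0" using assms by (simp add: d_def)
  from compl_brjuno_cover[OF assms(1) \<open>e > 0\<close> this]
  obtain I :: "nat set" and c r where cov: "\<forall>j\<in>I. 0 < r j \<and> r j < d"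
    "- brjuno_set \<subseteq> (\<Union>j\<in>I. ball (c j) (r j))"
    "\<forall>F. finite F \<longrightarrow> F \<subseteq> I \<longrightarrow> (\<Sum>j\<in>F. brjuno_gauge \<sigma> (2 * r j)) \<le> e"
    by (elim exE conjE)
  have "hausdorff_pre (brjuno_gauge \<sigma>) \<epsilon> (- brjuno_set)
      \<le> (\<Sum>\<^sub>\<infinity>j\<in>I. ennreal (brjuno_gauge \<sigma> (r j)))"
    unfolding hausdorff_pre_def
  proof (rule Inf_lower, intro CollectI exI conjI)
    show "\<forall>j\<in>I. 0 < r j \<and> r j < \<epsilon>" using cov(1) by (auto simp: d_def)
  qed (use cov(2) in auto)
  also have "\<dots> \<le> ennreal e"
  proof (rule infsum_le_finite_sums)
    show "(\<lambda>j. ennreal (brjuno_gauge \<sigma> (r j))) summable_on I"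
      by (rule nonneg_summable_on_complete) simp
    fix F assume F: "finite F" "F \<subseteq> I"
    have "(\<Sum>j\<in>F. brjuno_gauge \<sigma> (r j)) \<le> (\<Sum>j\<in>F. brjuno_gauge \<sigma> (2 * r j))"
      using cov(1) F assms by (intro sum_mono brjuno_gauge_mono) (auto simp: d_def dest!: subsetD)
    also have "\<dots> \<le> e" using cov(3) F by blast
    finally show "(\<Sum>j\<in>F. ennreal (brjuno_gauge \<sigma> (r j))) \<le> ennreal e"
      by (simp add: sum_ennreal brjuno_gauge_nonneg ennreal_leI)
  qed
  finally show "hausdorff_pre (brjuno_gauge \<sigma>) \<epsilon> (- brjuno_set) \<le> ennreal e" .
qed

lemma hausdorff_measure_compl_brjuno:
  assumes "\<sigma> > 2"
  shows "hausdorff_measure (brjuno_gauge \<sigma>) (- brjuno_set) = 0"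
  unfolding hausdorff_measure_def
proof (rule tendsto_Lim)
  have "\<forall>\<^sub>F \<epsilon> in at_right 0. hausdorff_pre (brjuno_gauge \<sigma>) \<epsilon> (- brjuno_set) = 0"
    using eventually_at_right_less[of "0::real"]
    by eventually_elim (rule hausdorff_pre_compl_brjuno[OF assms])
  then show "((\<lambda>\<epsilon>. hausdorff_pre (brjuno_gauge \<sigma>) \<epsilon> (- brjuno_set)) \<longlongrightarrow> 0) (at_right 0)"
    by (rule tendsto_eventually)
qed simp

subsection \<open>Measurability\<close>

lemma cf_rem_measurable [measurable]: "(\<lambda>\<alpha>. cf_rem \<alpha> n) \<in> borel_measurable borel"
proof (induction n)
  case (Suc n)
  note [measurable] = Suc
  show ?case unfolding cf_rem.simps by measurable
qed (simp add: borel_measurable_diff)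

lemma cf_coeff_measurable: "(\<lambda>\<alpha>. cf_coeff \<alpha> n) \<in> borel \<rightarrow>\<^sub>M count_space UNIV"
proof (cases n)
  case (Suc m)
  show ?thesis unfolding Suc cf_coeff.simps by measurable
qed simp

text \<open>Products of countable discrete spaces are discrete. This makes denominators measurable,
  since they depend on \<open>\<alpha>\<close> only through a finite list of integers.\<close>

lemma measurable_map_count_space:
  fixes f :: "'a \<Rightarrow> 'b \<Rightarrow> 'c :: countable"
  assumes "\<And>i. i \<in> set xs \<Longrightarrow> (\<lambda>x. f x i) \<in> M \<rightarrow>\<^sub>M count_space UNIV"
  shows "(\<lambda>x. map (f x) xs) \<in> M \<rightarrow>\<^sub>M count_space UNIV"
  using assms
proof (induction xs)
  case (Cons i xs)
  have "(\<lambda>x. (f x i, map (f x) xs)) \<in> M \<rightarrow>\<^sub>M count_space UNIV \<Otimes>\<^sub>M count_space UNIV"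
    using Cons by (intro measurable_Pair) auto
  also have "count_space UNIV \<Otimes>\<^sub>M count_space UNIV = count_space (UNIV :: ('c \<times> 'c list) set)"
    by (simp add: pair_measure_countable)
  finally have "(\<lambda>x. case (f x i, map (f x) xs) of (y, ys) \<Rightarrow> y # ys) \<in> M \<rightarrow>\<^sub>M count_space UNIV"
    by (rule measurable_compose) simp
  then show ?case by simp
qed simp

lemma cf_denom_measurable: "(\<lambda>\<alpha>. real_of_int (cf_denom \<alpha> n)) \<in> borel_measurable borel"
proof -
  have *: "(\<lambda>\<alpha>. map (cf_coeff \<alpha>) [0..<Suc n]) \<in> borel \<rightarrow>\<^sub>M count_space UNIV"
    by (rule measurable_map_count_space) (rule cf_coeff_measurable)
  show ?thesis unfolding cf_denom_def cf_convergent_def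
    by (rule measurable_compose[OF *]) simp
qed

text \<open>Convergence of real partial sums is the Cauchy property, a countable combination of
  measurable conditions.\<close>

lemma borel_Collect_summable:
  fixes f :: "nat \<Rightarrow> 'a \<Rightarrow> real"
  assumes "\<And>n. f n \<in> borel_measurable M"
  shows "{x \<in> space M. summable (\<lambda>n. f n x)} \<in> sets M"
proof -
  have "{x \<in> space M. Cauchy (\<lambda>n. \<Sum>i<n. f i x)} \<in> sets M"
    by (intro sets_Collect_Cauchy borel_measurable_sum assms)
  then show ?thesis by (simp only: summable_iff_convergent Cauchy_convergent_iff)
qed

lemma brjuno_set_borel: "brjuno_set \<in> sets borel"
proof -
  have rat: "(\<rat> :: real set) \<in> sets borel"
    by (rule sets.countable[OF _ countable_rat]) (rule borel_closed closed_singleton)+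
  have conv: "{\<alpha> \<in> space borel. summable (\<lambda>n.
      ln (real_of_int (cf_denom \<alpha> (n + 2))) / real_of_int (cf_denom \<alpha> (n + 1)))} \<in> sets borel"
    by (rule borel_Collect_summable)
      (rule borel_measurable_divide borel_measurable_ln cf_denom_measurable)+
  have "brjuno_set = {\<alpha> \<in> space borel. summable (\<lambda>n.
      ln (real_of_int (cf_denom \<alpha> (n + 2))) / real_of_int (cf_denom \<alpha> (n + 1)))} - \<rat>"
    by (simp only: brjuno_set_def space_borel) blast
  then show ?thesis using sets.Diff[OF conv rat] by (simp only:)
qed

text \<open>The image is the intersection of the closed real axis with a preimage under
  \<open>Re\<close>.\<close>

lemma borel_image_complex_of_real:
  assumes "A \<in> sets borel"
  shows "complex_of_real ` A \<in> sets borel"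
proof -
  have "complex_of_real ` A = Re -` A \<inter> space borel \<inter> {z. Im z = 0}"
    by (auto simp: complex_eq_iff image_iff)
  moreover have "{z. Im z = 0} \<in> sets borel"
    by (intro borel_closed closed_Collect_eq continuous_on_Im continuous_on_const continuous_on_id)
  moreover have "Re -` A \<inter> space borel \<in> sets borel"
    by (rule measurable_sets[OF borel_measurable_Re assms])
  ultimately show ?thesis by (simp only: sets.Int)
qed

theorem theorem1p3:
  fixes \<sigma> :: real
  assumes "\<sigma> > 2"
  shows "has_capacity (brjuno_kernel \<sigma>) (complex_of_real ` (- brjuno_set)) 0 \<and>
         hausdorff_measure (brjuno_gauge \<sigma>) (- brjuno_set) = 0"
proof -
  have "complex_of_real ` (- brjuno_set) \<in> sets borel"
    by (intro borel_image_complex_of_real borel_comp brjuno_set_borel)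
  moreover have "inner_capacity (brjuno_kernel \<sigma>) (complex_of_real ` (- brjuno_set)) = 0"
    using inner_capacity_le_outer[of "brjuno_kernel \<sigma>" "complex_of_real ` (- brjuno_set)"]
      outer_capacity_compl_brjuno[OF assms] by simp
  ultimately show ?thesis
    using outer_capacity_compl_brjuno[OF assms] hausdorff_measure_compl_brjuno[OF assms]
    by (simp add: has_capacity_def)
qed

end
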